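(* Assume $0<q<1$ and let $\Delta_q:=\{1,q,q^2,\dots\}\cup\{0\}\subset[0,1]$. (i) The formulas $$\tilde v_{n,k}=\sum_{x\in\Delta_q}\tilde\Phi_{n,k}(x)\,\mu(x),\qquad v_{n,k}=\sum_{x\in\Delta_q}\Phi_{n,k}(x)\,\mu(x),\qquad 0\le k\le n,$$ establish a linear (i.e. compatible with convex combinations) homeomorphism between the set $\widetilde{\mathcal V}$ (respectively, $\mathcal V$) and the set of all probability measures $\mu$ on $\Delta_q$. (ii) Given $\tilde v\in\widetilde{\mathcal V}$, the corresponding measure $\mu$ is determined by $$\mu(q^{\varkappa})=\lim_{\nu\to\infty}\tilde v_{\nu,\varkappa},\qquad \varkappa=0,1,2,\dots;\qquad \mu(0)=1-\sum_{\varkappa\in\{0,1,\dots\}}\mu(q^{\varkappa}).$$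
   Context: Notation: $[n]:=1+q+\dots+q^{n-1}$, $[n]!:=[1][2]\cdots[n]$ (with $[0]!=1$), and $d_{n,k}:=\frac{[n]!}{[k]!\,[n-k]!}$ for $0\le k\le n$ (the $q$-binomial coefficient). For $0\le k\le n$ define the polynomials $$\Phi_{n,k}(x):=q^{-k(n-k)}x^{n-k}\prod_{i=0}^{k-1}(1-xq^{-i}),\qquad \tilde\Phi_{n,k}(x):=d_{n,k}\Phi_{n,k}(x),$$ regarded as functions on $\Delta_q$ (with $x^0=1$ also at $x=0$, and empty products equal to $1$). $\mathcal V$ is the set of all arrays $v=(v_{n,k})_{0\le k\le n<\infty}$ of nonnegative reals with $v_{0,0}=1$ and $$v_{n,k}=v_{n+1,k}+q^{n-k}v_{n+1,k+1},\qquad 0\le k\le n.$$ $\widetilde{\mathcal V}$ is the set of arrays $\tilde v=(\tilde v_{n,k})$ of the form $\tilde v_{n,k}=d_{n,k}v_{n,k}$ with $v\in\mathcal V$. Both $\mathcal V$ and $\widetilde{\mathcal V}$ carry the product topology (entrywise convergence). The set of probability measures on the compact set $\Delta_q$ carries the weak topology. For a measure $\mu$, $\mu(x)$ denotes the atomic mass $\mu(\{x\})$. *)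

theory Defs
  imports "HOL-Probability.Probability"
begin

definition qint :: "real \<Rightarrow> nat \<Rightarrow> real" where
  "qint q n = (\<Sum>i<n. q ^ i)"

definition qfact :: "real \<Rightarrow> nat \<Rightarrow> real" where
  "qfact q n = (\<Prod>i=1..n. qint q i)"

definition qdim :: "real \<Rightarrow> nat \<Rightarrow> nat \<Rightarrow> real" where
  "qdim q n k = qfact q n / (qfact q k * qfact q (n - k))"

definition Delta :: "real \<Rightarrow> real set" where
  "Delta q = range (\<lambda>m::nat. q ^ m) \<union> {0}"

definition Phi :: "real \<Rightarrow> nat \<Rightarrow> nat \<Rightarrow> real \<Rightarrow> real" where
  "Phi q n k x =
     q powi (- int (k * (n - k))) * x ^ (n - k) * (\<Prod>i<k. 1 - x * q powi (- int i))"

definition Phi_tilde :: "real \<Rightarrow> nat \<Rightarrow> nat \<Rightarrow> real \<Rightarrow> real" where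
  "Phi_tilde q n k x = qdim q n k * Phi q n k x"

text \<open>Triangular arrays are functions on pairs \<open>(n, k)\<close> that are extensional on \<open>tri\<close>,
  i.e. \<open>undefined\<close> outside it, so that two arrays are equal iff their entries agree.\<close>

definition tri :: "(nat \<times> nat) set" where
  "tri = {(n, k). k \<le> n}"

definition VV :: "real \<Rightarrow> (nat \<times> nat \<Rightarrow> real) set" where
  "VV q = {v \<in> extensional tri.
     (\<forall>n k. k \<le> n \<longrightarrow> 0 \<le> v (n, k)) \<and>
     v (0, 0) = 1 \<and>
     (\<forall>n k. k \<le> n \<longrightarrow> v (n, k) = v (n + 1, k) + q ^ (n - k) * v (n + 1, k + 1))}"

definition VV_tilde :: "real \<Rightarrow> (nat \<times> nat \<Rightarrow> real) set" where
  "VV_tilde q = (\<lambda>v. \<lambda>(n, k)\<in>tri. qdim q n k * v (n, k)) ` VV q"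

definition entrywise_topology :: "(nat \<times> nat \<Rightarrow> real) set \<Rightarrow> (nat \<times> nat \<Rightarrow> real) topology" where
  "entrywise_topology A = subtopology (product_topology (\<lambda>_. euclideanreal) tri) A"

definition prob_measures :: "real set \<Rightarrow> real measure set" where
  "prob_measures D = {M. prob_space M \<and> sets M = sets (restrict_space borel D)}"

definition weak_topology :: "real set \<Rightarrow> real measure topology" where
  "weak_topology D = topology_generated_by
     {{M \<in> prob_measures D. (LINT x|M. f x) \<in> U} | f U.
        continuous_on D (f :: real \<Rightarrow> real) \<and> open U}"

lemma topspace_weak_topology: "topspace (weak_topology D) = prob_measures D"
proof -
  have "prob_measures D \<in> {{M \<in> prob_measures D. (LINT x|M. f x) \<in> U} | f U.
          continuous_on D (f :: real \<Rightarrow> real) \<and> open U}"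
    by (rule CollectI, rule exI[of _ "\<lambda>_. 0"], rule exI[of _ UNIV]) auto
  then show ?thesis
    unfolding weak_topology_def topology_generated_by_topspace by blast
qed

text \<open>The convex combination \<open>t M + (1 - t) N\<close> of two measures on the same measurable space;
  see \<open>emeasure_mixture\<close>.\<close>

definition mixture :: "real \<Rightarrow> 'a measure \<Rightarrow> 'a measure \<Rightarrow> 'a measure" where
  "mixture t M N = measure_of (space M) (sets M)
     (\<lambda>A. ennreal t * emeasure M A + ennreal (1 - t) * emeasure N A)"

lemma sets_mixture [simp]: "sets (mixture t M N) = sets M"
  by (simp add: mixture_def)

lemma emeasure_mixture:
  assumes "sets N = sets M" and "A \<in> sets M"
  shows "emeasure (mixture t M N) A = ennreal t * emeasure M A + ennreal (1 - t) * emeasure N A"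
  unfolding mixture_def
proof (rule emeasure_measure_of_sigma[OF sets.sigma_algebra_axioms _ _ assms(2)])
  show "positive (sets M) (\<lambda>A. ennreal t * emeasure M A + ennreal (1 - t) * emeasure N A)"
    by (simp add: positive_def)
  show "countably_additive (sets M) (\<lambda>A. ennreal t * emeasure M A + ennreal (1 - t) * emeasure N A)"
  proof (rule countably_additiveI)
    fix B :: "nat \<Rightarrow> _" assume B: "range B \<subseteq> sets M" "disjoint_family B"
    have "range B \<subseteq> sets N" using B assms by simp
    then show "(\<Sum>i. ennreal t * emeasure M (B i) + ennreal (1 - t) * emeasure N (B i)) =
        ennreal t * emeasure M (\<Union>i. B i) + ennreal (1 - t) * emeasure N (\<Union>i. B i)"
      using B by (simp add: suminf_add[symmetric] suminf_emeasure)
  qed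
qed

definition array_of :: "real \<Rightarrow> real measure \<Rightarrow> nat \<times> nat \<Rightarrow> real" where
  "array_of q M = (\<lambda>(n, k)\<in>tri. \<Sum>\<^sub>\<infinity>x\<in>Delta q. Phi q n k x * measure M {x})"

definition array_of_tilde :: "real \<Rightarrow> real measure \<Rightarrow> nat \<times> nat \<Rightarrow> real" where
  "array_of_tilde q M = (\<lambda>(n, k)\<in>tri. \<Sum>\<^sub>\<infinity>x\<in>Delta q. Phi_tilde q n k x * measure M {x})"

end

theory Submission
  imports Defs
begin

text \<open>
  Write \<open>t n k = d n k * v (n, k)\<close>. For fixed \<open>n\<close> these are the weights of a probability
  distribution on \<open>{0..n}\<close>, and passing from level \<open>n + 1\<close> to level \<open>n\<close> the index either stays or
  drops by one. Hence the partial sums over \<open>j \<le> k\<close> decrease in \<open>n\<close>, so \<open>t n k\<close> has a limit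
  \<open>\<mu> k\<close>, the candidate for the mass at \<open>q ^ k\<close>. Counting paths from \<open>(n, 0)\<close> to level \<open>N\<close> gives
  \<open>v (n, 0)\<close> as the sum over \<open>k\<close> of \<open>q ^ (n * k) * (d (N - n) k / d N k) * t N k\<close>; the ratio tends to
  1, and for \<open>n \<ge> 1\<close> the factor \<open>q ^ (n * k)\<close> dominates, so Tannery's theorem identifies
  \<open>v (n, 0)\<close> with the \<open>n\<close>-th moment of \<open>\<mu>\<close>. The recursion recovers an array from its first
  column, so \<open>v\<close> is the array of \<open>\<mu>\<close>. Conversely \<open>\<mu>\<close> is recovered from its array because
  \<open>Phi_tilde n k\<close> stays in \<open>[0, 1]\<close> and tends pointwise on \<open>Delta q\<close> to the indicator of
  \<open>q ^ k\<close>. The inverse map is continuous since the moments are entries of the array and, by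
  Weierstrass, control all integrals of continuous functions.
\<close>

section \<open>Arrays and q-binomial coefficients\<close>

text \<open>The q-binomial coefficient, given by its q-Pascal rule. Unlike \<open>qdim\<close> it
  vanishes for k > n, so row sums may run past the diagonal.\<close>

fun qbinom :: "real \<Rightarrow> nat \<Rightarrow> nat \<Rightarrow> real" where
  "qbinom q n 0 = 1"
| "qbinom q 0 (Suc k) = 0"
| "qbinom q (Suc n) (Suc k) = qbinom q n (Suc k) + q ^ (n - k) * qbinom q n k"

lemma qbinom_eq_0: "n < k \<Longrightarrow> qbinom q n k = 0"
  by (induction q n k rule: qbinom.induct) auto

lemma qbinom_diag: "qbinom q n n = 1"
  by (induction n) (auto simp: qbinom_eq_0)

lemma one_minus_mult_qint: "(1 - q) * qint q n = 1 - q ^ n"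
  unfolding qint_def by (rule one_diff_power_eq[symmetric])

section \<open>Arrays in \<open>VV q\<close>: recursion, first column and path counts\<close>

lemma VV_D:
  assumes "v \<in> VV q"
  shows VV_extensional: "v \<in> extensional tri"
    and VV_nonneg: "k \<le> n \<Longrightarrow> 0 \<le> v (n, k)"
    and VV_0: "v (0, 0) = 1"
    and VV_rec: "k \<le> n \<Longrightarrow> v (n, k) = v (Suc n, k) + q ^ (n - k) * v (Suc n, Suc k)"
  using assms unfolding VV_def Suc_eq_plus1 by blast+

lemma VV_I:
  assumes "v \<in> extensional tri" and "\<And>n k. k \<le> n \<Longrightarrow> 0 \<le> v (n, k)" and "v (0, 0) = 1"
    and "\<And>n k. k \<le> n \<Longrightarrow> v (n, k) = v (Suc n, k) + q ^ (n - k) * v (Suc n, Suc k)"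
  shows "v \<in> VV q"
  using assms unfolding VV_def Suc_eq_plus1 by blast

text \<open>Induction on the column: solved for \<open>v (Suc n, Suc k)\<close>, the recursion
  computes column k + 1 from column k, dividing by \<open>q ^ (n - k)\<close>.\<close>

lemma VV_eqI:
  assumes "q \<noteq> 0" "v \<in> VV q" "w \<in> VV q" and col: "\<And>n. v (n, 0) = w (n, 0)"
  shows "v = w"
proof -
  have "\<forall>n\<ge>k. v (n, k) = w (n, k)" for k
  proof (induction k)
    case (Suc k)
    have "v (Suc n, Suc k) = w (Suc n, Suc k)" if "k \<le> n" for n
      using VV_rec[OF assms(2) that] VV_rec[OF assms(3) that] Suc that assms(1) by auto
    then show ?case
      by (metis Suc_le_D Suc_le_mono)
  qed (simp add: col)
  moreover have "v \<in> extensional tri" "w \<in> extensional tri"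
    using assms by (simp_all add: VV_extensional)
  ultimately show ?thesis
    by (intro extensionalityI[of _ tri]) (auto simp: tri_def)
qed

text \<open>\<^term>\<open>q ^ (n * k) * qbinom q m k\<close> is the weighted number of paths from \<open>(n, 0)\<close> to
  \<open>(n + m, k)\<close>: moving the start from level \<open>0\<close> to level \<open>n\<close> multiplies each of the \<open>k\<close>
  upward steps by \<open>q ^ n\<close>.\<close>

lemma VV_first_column:
  assumes "v \<in> VV q"
  shows "v (n, 0) = (\<Sum>k\<le>m. q ^ (n * k) * qbinom q m k * v (n + m, k))"
proof (induction m)
  case (Suc m)
  define g where "g k = q ^ (n * k) * qbinom q m k" for k
  have "q ^ (n * k) * (q ^ (n + m - k)) = q ^ (n * Suc k) * q ^ (m - k)" if "k \<le> m" for k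
    using that by (auto simp: le_iff_add algebra_simps simp flip: power_add)
  then have eq: "g k * q ^ (n + m - k) = q ^ (n * Suc k) * (q ^ (m - k) * qbinom q m k)" if "k \<le> m" for k
    using that by (simp add: g_def)
  have "v (n, 0) = (\<Sum>k\<le>m. g k * v (n + m, k))"
    using Suc by (simp add: g_def)
  also have "\<dots> = (\<Sum>k\<le>m. g k * v (n + Suc m, k)) +
      (\<Sum>k\<le>m. q ^ (n * Suc k) * (q ^ (m - k) * qbinom q m k) * v (n + Suc m, Suc k))"
    unfolding sum.distrib[symmetric]
  proof (rule sum.cong)
    fix k assume "k \<in> {..m}"
    then show "g k * v (n + m, k) = g k * v (n + Suc m, k) +
        q ^ (n * Suc k) * (q ^ (m - k) * qbinom q m k) * v (n + Suc m, Suc k)"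
      using VV_rec[OF assms, of k "n + m"] eq[of k] by (simp add: distrib_left flip: mult.assoc)
  qed simp
  \<comment> \<open>The added term is 0 because \<open>qbinom q m (Suc m) = 0\<close>. Once the term
    of index 0 is split off, this sum runs over the same entries as the other one, and the q-Pascal
    rule merges the two.\<close>
  also have "(\<Sum>k\<le>m. g k * v (n + Suc m, k)) = (\<Sum>k\<le>Suc m. g k * v (n + Suc m, k))"
    by (simp add: g_def qbinom_eq_0)
  also have "\<dots> = v (n + Suc m, 0) + (\<Sum>k\<le>m. g (Suc k) * v (n + Suc m, Suc k))"
    by (subst sum.atMost_Suc_shift) (simp add: g_def)
  also have "\<dots> + (\<Sum>k\<le>m. q ^ (n * Suc k) * (q ^ (m - k) * qbinom q m k) * v (n + Suc m, Suc k)) =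
      (\<Sum>k\<le>Suc m. q ^ (n * k) * qbinom q (Suc m) k * v (n + Suc m, k))"
    by (subst sum.atMost_Suc_shift) (simp add: g_def algebra_simps sum.distrib)
  finally show ?case .
qed simp

text \<open>In the flow of mass from level n + 1 to level n, everything that ends at an index up to
  k starts at an index up to k, except for what drops from k + 1 to k. The last term is that
  amount.\<close>

lemma VV_cumulative_step:
  assumes "v \<in> VV q" and "k \<le> n"
  shows "(\<Sum>j\<le>k. qbinom q n j * v (n, j)) =
    (\<Sum>j\<le>k. qbinom q (Suc n) j * v (Suc n, j)) + qbinom q n k * q ^ (n - k) * v (Suc n, Suc k)"
  using assms(2)
proof (induction k)
  case 0
  then show ?case using VV_rec[OF assms(1), of 0 n] by simp
next
  case (Suc k)
  then show ?case
    using VV_rec[OF assms(1), of "Suc k" n] by (simp add: algebra_simps)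
qed

context
  fixes q :: real
  assumes q: "0 < q" "q < 1"
begin

section \<open>q-integers and q-binomial coefficients for 0 < q < 1\<close>

lemma qint_pos: "0 < n \<Longrightarrow> 0 < qint q n"
  unfolding qint_def using q by (intro sum_pos) auto

lemma qfact_pos: "0 < qfact q n"
  unfolding qfact_def by (intro prod_pos) (auto intro: qint_pos)

lemma qint_add: "qint q (m + n) = qint q m + q ^ m * qint q n"
proof -
  have "(1 - q) * qint q (m + n) = (1 - q) * (qint q m + q ^ m * qint q n)"
    using one_minus_mult_qint[of q m] one_minus_mult_qint[of q n]
    by (simp add: one_minus_mult_qint distrib_left mult.left_commute[of "1 - q"])
      (simp add: power_add right_diff_distrib)
  then show ?thesis
    using q by simp
qed

lemma qfact_Suc: "qfact q (Suc n) = qfact q n * qint q (Suc n)"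
  by (simp add: qfact_def)

text \<open>With n = k + m + 1, clearing the q-factorials reduces the claim to [n+1] = [m+1] +
  q^(m+1) [k+1]. The case k = n is excluded because \<open>qdim q n (Suc n)\<close> is not
  0.\<close>

lemma qdim_Suc_Suc:
  assumes "k < n"
  shows "qdim q (Suc n) (Suc k) = qdim q n (Suc k) + q ^ (n - k) * qdim q n k"
proof -
  obtain m where n: "n = Suc (k + m)"
    using assms less_iff_Suc_add by auto
  have "qint q (Suc n) = qint q (Suc m) + q ^ Suc m * qint q (Suc k)"
    using qint_add[of "Suc m" "Suc k"] by (simp add: n add.commute)
  moreover have "qfact q j \<noteq> 0" "qint q (Suc j) \<noteq> 0" for j
    using qfact_pos[of j] qint_pos[of "Suc j"] by auto
  ultimately show ?thesis
    by (simp add: qdim_def n qfact_Suc divide_simps) (simp add: algebra_simps)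
qed

lemma qdim_eq_qbinom: "k \<le> n \<Longrightarrow> qdim q n k = qbinom q n k"
proof (induction n arbitrary: k)
  case 0
  then show ?case by (simp add: qdim_def qfact_def)
next
  case (Suc n)
  have ne: "qfact q j \<noteq> 0" for j
    using qfact_pos[of j] by simp
  show ?case
  proof (cases k)
    case 0
    then show ?thesis using ne by (simp add: qdim_def) (simp add: qfact_def)
  next
    case k: (Suc j)
    show ?thesis
    proof (cases "j = n")
      case True
      then show ?thesis using ne k qbinom_diag[of q "Suc n"] by (simp add: qdim_def) (simp add: qfact_def)
    next
      case False
      then show ?thesis using Suc k by (simp add: qdim_Suc_Suc)
    qed
  qed
qed

lemma qbinom_nonneg: "0 \<le> qbinom q n k"
  using q by (induction q n k rule: qbinom.induct) auto

lemma qbinom_pos: "k \<le> n \<Longrightarrow> 0 < qbinom q n k"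
  using qfact_pos by (simp flip: qdim_eq_qbinom add: qdim_def)

lemma incseq_qbinom: "incseq (\<lambda>n. qbinom q n k)"
proof (rule incseq_SucI)
  show "qbinom q n k \<le> qbinom q (Suc n) k" for n
    using q qbinom_nonneg by (cases k) auto
qed

text \<open>This is [k+1] d(n,k+1) = [n-k] d(n,k) multiplied by 1 - q, a form in which the limit in
  n can be read off. For k = n the right side vanishes through \<open>1 - q ^ 0\<close>, for k > n
  through the coefficients.\<close>

lemma qbinom_absorb: "qbinom q n (Suc k) * (1 - q ^ Suc k) = qbinom q n k * (1 - q ^ (n - k))"
proof (cases "k < n")
  case True
  then obtain m where n: "n = Suc (k + m)"
    using less_iff_Suc_add by auto
  have ne: "qfact q j \<noteq> 0" "qint q (Suc j) \<noteq> 0" for j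
    using qfact_pos[of j] qint_pos[of "Suc j"] by auto
  have "qdim q n (Suc k) * qint q (Suc k) = qdim q n k * qint q (n - k)"
    using ne by (simp add: n qdim_def qfact_Suc Suc_diff_le)
  then have "qbinom q n (Suc k) * qint q (Suc k) = qbinom q n k * qint q (n - k)"
    using True by (simp add: qdim_eq_qbinom)
  then show ?thesis
    unfolding one_minus_mult_qint[symmetric] by (simp add: mult.left_commute[of _ "1 - q"])
qed (simp add: qbinom_eq_0)

lemma qpow_less_1: "0 < k \<Longrightarrow> q ^ k < 1"
  using q by (simp add: power_less_one_iff)

text \<open>By \<open>qbinom_absorb\<close>, passing from k to k + 1 divides the limit by
  \<open>1 - q ^ Suc k\<close>.\<close>

lemma qbinom_tendsto: "(\<lambda>n. qbinom q n k) \<longlonglongrightarrow> inverse (\<Prod>i<k. 1 - q ^ Suc i)"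
proof (induction k)
  case (Suc k)
  have "(\<lambda>n. q ^ (n - k)) \<longlonglongrightarrow> 0"
    by (rule LIMSEQ_offset[of _ k]) (use q in \<open>simp add: LIMSEQ_power_zero\<close>)
  then have "(\<lambda>n. qbinom q n k * (1 - q ^ (n - k)) / (1 - q ^ Suc k)) \<longlonglongrightarrow>
      inverse (\<Prod>i<k. 1 - q ^ Suc i) * (1 - 0) / (1 - q ^ Suc k)"
    using qpow_less_1[of "Suc k"] by (intro tendsto_intros Suc) auto
  moreover have "qbinom q n k * (1 - q ^ (n - k)) / (1 - q ^ Suc k) = qbinom q n (Suc k)" for n
    using qpow_less_1[of "Suc k"] by (simp flip: qbinom_absorb)
  ultimately show ?case
    by (simp add: field_simps)
qed simp

section \<open>Monotone partial sums, limits and moments of an array\<close>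

lemma VV_cumulative_decreasing:
  assumes "v \<in> VV q"
  shows "(\<Sum>j\<le>k. qbinom q (Suc n) j * v (Suc n, j)) \<le> (\<Sum>j\<le>k. qbinom q n j * v (n, j))"
proof -
  have *: "(\<Sum>j\<le>k. qbinom q (Suc n) j * v (Suc n, j)) \<le> (\<Sum>j\<le>k. qbinom q n j * v (n, j))"
    if "k \<le> n" for k
    using VV_cumulative_step[OF assms that] VV_nonneg[OF assms, of "Suc k" "Suc n"] that q qbinom_nonneg[of n k]
    by simp
  show ?thesis
  proof (cases "k \<le> n")
    case False
    \<comment> \<open>For k > n both sides are total masses of their rows. These agree:
      \<open>VV_cumulative_step\<close> with k = n has as its last term exactly the diagonal term of
      row n + 1.\<close>
    have tail: "(\<Sum>j\<le>k. qbinom q m j * v (m, j)) = (\<Sum>j\<le>m. qbinom q m j * v (m, j))" if "m \<le> k" for m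
      using that by (intro sum.mono_neutral_right) (auto simp: qbinom_eq_0)
    show ?thesis
      using False VV_cumulative_step[OF assms, of n n] tail[of n] tail[of "Suc n"]
      by (simp add: qbinom_diag)
  qed (rule *)
qed

lemma VV_scaled_nonneg: "v \<in> VV q \<Longrightarrow> 0 \<le> qbinom q n k * v (n, k)"
  using qbinom_nonneg[of n k] VV_nonneg[of v q k n] by (cases "k \<le> n") (auto simp: qbinom_eq_0)

lemma VV_cumulative_le_1:
  assumes "v \<in> VV q"
  shows "(\<Sum>j\<le>k. qbinom q n j * v (n, j)) \<le> 1"
proof (induction n)
  case 0
  have "(\<Sum>j\<le>k. qbinom q 0 j * v (0, j)) = (\<Sum>j\<le>0. qbinom q 0 j * v (0, j))"
    by (intro sum.mono_neutral_right) (auto simp: qbinom_eq_0)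
  then show ?case using VV_0[OF assms] by simp
qed (use VV_cumulative_decreasing[OF assms] order_trans in blast)

lemma VV_scaled_le_1:
  assumes "v \<in> VV q"
  shows "qbinom q n k * v (n, k) \<le> 1"
  using VV_cumulative_le_1[OF assms, of n k] member_le_sum[of k "{..k}" "\<lambda>j. qbinom q n j * v (n, j)"]
    VV_scaled_nonneg[OF assms] by force

lemma VV_scaled_convergent:
  assumes "v \<in> VV q"
  shows "convergent (\<lambda>n. qbinom q n k * v (n, k))"
proof -
  have C: "convergent (\<lambda>n. \<Sum>j\<le>k. qbinom q n j * v (n, j))" for k
  proof -
    have "decseq (\<lambda>n. \<Sum>j\<le>k. qbinom q n j * v (n, j))"
      by (intro decseq_SucI VV_cumulative_decreasing assms)
    moreover have "0 \<le> (\<Sum>j\<le>k. qbinom q n j * v (n, j))" for n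
      by (intro sum_nonneg VV_scaled_nonneg assms)
    ultimately show ?thesis
      using decseq_convergent[of "\<lambda>n. \<Sum>j\<le>k. qbinom q n j * v (n, j)" 0] unfolding convergent_def by metis
  qed
  show ?thesis
  proof (cases k)
    case 0
    then show ?thesis using C[of 0] by simp
  next
    case (Suc j)
    then show ?thesis using convergent_diff[OF C[of k] C[of j]] by simp
  qed
qed

text \<open>Only moments of positive order and a total mass of at most 1 are claimed: mass may
  escape to k = infinity, that is to the point 0 of \<open>Delta q\<close>, and these moments do not
  see it.\<close>

lemma VV_first_column_moments:
  assumes v: "v \<in> VV q"
  obtains \<mu> where "\<And>k. 0 \<le> \<mu> k" "summable \<mu>" "suminf \<mu> \<le> 1" "\<And>n. v (Suc n, 0) = (\<Sum>k. q ^ (Suc n * k) * \<mu> k)"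
proof -
  define t where "t n k = qbinom q n k * v (n, k)" for n k
  define \<mu> where "\<mu> k = lim (\<lambda>n. t n k)" for k
  have lim: "(\<lambda>n. t n k) \<longlonglongrightarrow> \<mu> k" for k
    using VV_scaled_convergent[OF v, of k] by (simp add: \<mu>_def t_def convergent_LIMSEQ_iff)
  have nonneg: "0 \<le> \<mu> k" for k
    by (rule LIMSEQ_le_const[OF lim]) (auto simp: t_def VV_scaled_nonneg[OF v])
  have le: "(\<Sum>k<m. \<mu> k) \<le> 1" for m
  proof (rule LIMSEQ_le_const2)
    show "(\<lambda>n. \<Sum>k<m. t n k) \<longlonglongrightarrow> (\<Sum>k<m. \<mu> k)"
      by (intro tendsto_sum lim)
    have "(\<Sum>k<m. t n k) \<le> (\<Sum>k\<le>m. t n k)" for n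
      by (intro sum_mono2) (auto simp: t_def VV_scaled_nonneg[OF v])
    then have "(\<Sum>k<m. t n k) \<le> 1" for n
      using VV_cumulative_le_1[OF v, of n m] unfolding t_def by (rule order_trans)
    then show "\<exists>N. \<forall>n\<ge>N. (\<Sum>k<m. t n k) \<le> 1"
      by blast
  qed
  have sm: "summable \<mu>"
    by (rule summableI_nonneg_bounded[OF nonneg le])
  have column: "v (Suc n, 0) = (\<Sum>k. q ^ (Suc n * k) * \<mu> k)" for n
  proof -
    \<comment> \<open>The path-count summand with target level n + 1 + m. It is 0 for k > m, so the
      finite sum over k is a series and the limit in m can be taken term by term.\<close>
    define a where "a k m = q ^ (Suc n * k) * qbinom q m k * v (Suc n + m, k)" for k m
    have a_eq: "a k m = q ^ (Suc n * k) * (qbinom q m k / qbinom q (Suc n + m) k) * t (Suc n + m) k"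
      if "k \<le> m" for k m
      using qbinom_pos[of k "Suc n + m"] that by (simp add: a_def t_def del: qbinom.simps)
    have "v (Suc n, 0) = (\<Sum>k. a k m)" for m
    proof -
      have "v (Suc n, 0) = (\<Sum>k\<le>m. a k m)"
        using VV_first_column[OF v, of "Suc n" m] by (simp add: a_def)
      also have "\<dots> = (\<Sum>k. a k m)"
        by (rule suminf_finite[symmetric]) (auto simp: a_def qbinom_eq_0)
      finally show ?thesis .
    qed
    moreover have "(\<lambda>m. \<Sum>k. a k m) \<longlonglongrightarrow> (\<Sum>k. q ^ (Suc n * k) * \<mu> k)"
    proof (rule tannerys_theorem[THEN conjunct2, THEN conjunct2])
      fix k
      \<comment> \<open>Numerator and denominator of the ratio of q-binomials have the same limit;
        since that limit is nonzero, the ratio tends to 1.\<close>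
      have pos: "0 < (\<Prod>i<k. 1 - q ^ Suc i)"
        using qpow_less_1 by (intro prod_pos) (auto simp del: power_Suc)
      then have ne: "inverse (\<Prod>i<k. 1 - q ^ Suc i) \<noteq> 0"
        by (metis inverse_nonzero_iff_nonzero less_irrefl)
      have "(\<lambda>m. q ^ (Suc n * k) * (qbinom q m k / qbinom q (m + Suc n) k) * t (m + Suc n) k) \<longlonglongrightarrow>
          q ^ (Suc n * k) * (inverse (\<Prod>i<k. 1 - q ^ Suc i) / inverse (\<Prod>i<k. 1 - q ^ Suc i)) * \<mu> k"
        by (intro tendsto_intros qbinom_tendsto LIMSEQ_ignore_initial_segment[OF qbinom_tendsto]
            LIMSEQ_ignore_initial_segment[OF lim] ne)
      then have "(\<lambda>m. q ^ (Suc n * k) * (qbinom q m k / qbinom q (Suc n + m) k) * t (Suc n + m) k)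
          \<longlonglongrightarrow> q ^ (Suc n * k) * \<mu> k"
        by (simp only: add.commute[of "Suc n"] divide_self[OF ne] mult_1_right)
      moreover have "\<forall>\<^sub>F m in sequentially.
          q ^ (Suc n * k) * (qbinom q m k / qbinom q (Suc n + m) k) * t (Suc n + m) k = a k m"
        using eventually_ge_at_top[of k] by eventually_elim (rule a_eq[symmetric])
      ultimately show "(\<lambda>m. a k m) \<longlonglongrightarrow> q ^ (Suc n * k) * \<mu> k"
        by (rule Lim_transform_eventually)
    next
      \<comment> \<open>The majorant for Tannery's theorem. The ratio is at most 1 because
        q-binomials increase in the upper index, \<open>t\<close> is at most 1, and the exponent is
        at least k because the moment has order \<open>Suc n\<close>.\<close>
      have "norm (a k m) \<le> q ^ k" for k m
      proof (cases "k \<le> m")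
        case True
        have t: "0 \<le> t (Suc n + m) k" "t (Suc n + m) k \<le> 1"
          unfolding t_def by (rule VV_scaled_nonneg[OF v] VV_scaled_le_1[OF v])+
        have r: "0 \<le> qbinom q m k / qbinom q (Suc n + m) k" "qbinom q m k / qbinom q (Suc n + m) k \<le> 1"
          using qbinom_nonneg qbinom_pos[of k "Suc n + m"] True incseqD[OF incseq_qbinom[of k], of m "Suc n + m"]
          by (auto simp del: qbinom.simps intro: divide_nonneg_nonneg)
        define y where "y = (qbinom q m k / qbinom q (Suc n + m) k) * t (Suc n + m) k"
        have y: "0 \<le> y" "y \<le> 1"
          unfolding y_def by (rule mult_nonneg_nonneg[OF r(1) t(1)] mult_le_one[OF r(2) t])+
        have "q ^ (Suc n * k) \<le> q ^ k"
          using q by (intro power_decreasing) auto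
        then have "q ^ (Suc n * k) * y \<le> q ^ k * 1"
          using q y by (intro mult_mono) auto
        moreover have "0 \<le> q ^ (Suc n * k) * y"
          using q y by (intro mult_nonneg_nonneg) auto
        ultimately show ?thesis
          unfolding a_eq[OF True] mult.assoc y_def by (simp only: real_norm_def abs_of_nonneg mult_1_right)
      qed (use q in \<open>simp add: a_def qbinom_eq_0\<close>)
      then show "\<forall>\<^sub>F (k, m) in at_top \<times>\<^sub>F sequentially. norm (a k m) \<le> q ^ k"
        by (intro always_eventually) auto
    qed (use q in \<open>auto simp: summable_geometric\<close>)
    ultimately show ?thesis
      by (simp add: LIMSEQ_const_iff)
  qed
  show thesis
    using that[of \<mu>] nonneg sm le suminf_le_const[OF sm le] column by simp
qed

end

section \<open>Measures on Delta and their arrays\<close>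

text \<open>A measure on all subsets of a countable set is the counting measure with its atom masses
  as density, so the integral of a bounded function is an absolutely convergent sum over
  atoms.\<close>

lemma countable_space_integral:
  fixes f :: "'a \<Rightarrow> real"
  assumes "prob_space M" and sets: "sets M = Pow D" and D: "countable D"
    and f: "\<And>x. x \<in> D \<Longrightarrow> \<bar>f x\<bar> \<le> B"
  shows countable_space_integrable: "integrable M f"
    and countable_space_has_sum: "((\<lambda>x. f x * measure M {x}) has_sum (LINT x|M. f x)) D"
proof -
  interpret prob_space M by fact
  have space: "space M = D"
    using sets by (metis Pow_top sets.sets_into_space sets.top subset_antisym Pow_iff)
  have M: "M = density (count_space D) (\<lambda>x. ennreal (measure M {x}))"
    unfolding point_measure_def[symmetric]
  proof (rule measure_eqI_countable[OF sets _ D])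
    show "emeasure M {a} = emeasure (point_measure D (\<lambda>x. ennreal (measure M {x}))) {a}" if "a \<in> D" for a
      using that by (subst emeasure_point_measure_finite2) (auto simp: emeasure_eq_measure)
  qed (simp add: sets_point_measure)
  have meas: "f \<in> borel_measurable M"
    using sets by (auto simp: measurable_def space)
  show int: "integrable M f"
    using f by (intro integrable_const_bound[of _ B] meas) (auto simp: space)
  have "integrable (density (count_space D) (\<lambda>x. ennreal (measure M {x}))) f"
    using int M by simp
  then have "integrable (count_space D) (\<lambda>x. measure M {x} *\<^sub>R f x)"
    by (subst (asm) integrable_density) auto
  then have abs: "Infinite_Set_Sum.abs_summable_on (\<lambda>x. f x * measure M {x}) D"
    by (simp add: Infinite_Set_Sum.abs_summable_on_def mult.commute)
  then have "Infinite_Sum.abs_summable_on (\<lambda>x. f x * measure M {x}) D"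
    by (simp only: abs_summable_equivalent)
  then have sm: "(\<lambda>x. f x * measure M {x}) summable_on D"
    by (rule abs_summable_summable)
  have "(LINT x|M. f x) = (LINT x|density (count_space D) (\<lambda>x. ennreal (measure M {x})). f x)"
    using M by simp
  also have "\<dots> = infsetsum (\<lambda>x. f x * measure M {x}) D"
    by (subst integral_density) (auto simp: infsetsum_def mult.commute)
  also have "\<dots> = infsum (\<lambda>x. f x * measure M {x}) D"
    by (rule infsetsum_infsum[OF abs])
  finally show "((\<lambda>x. f x * measure M {x}) has_sum (LINT x|M. f x)) D"
    using sm by simp
qed

section \<open>The countable compact space \<open>Delta q\<close> and its probability
  measures\<close>

lemma Delta_eq: "Delta q = insert 0 (range (\<lambda>m. q ^ m))"
  by (auto simp: Delta_def)

lemma countable_Delta: "countable (Delta q)"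
  by (simp add: Delta_eq)

lemma sets_Delta: "sets (restrict_space borel (Delta q)) = Pow (Delta q)"
proof (rule sets_eq_countable[OF countable_Delta])
  show "{x} \<in> sets (restrict_space borel (Delta q))" if "x \<in> Delta q" for x
    using that countable_Delta[of q] by (subst sets_restrict_space_iff) (auto simp: borel_closed intro: sets.countable)
qed (simp add: space_restrict_space)

lemma prob_measures_Delta_iff:
  "M \<in> prob_measures (Delta q) \<longleftrightarrow> prob_space M \<and> sets M = Pow (Delta q)"
  by (simp add: prob_measures_def sets_Delta)

lemma space_prob_measures_Delta: "M \<in> prob_measures (Delta q) \<Longrightarrow> space M = Delta q"
  unfolding prob_measures_Delta_iff by (metis Pow_top sets.sets_into_space sets.top subset_antisym Pow_iff)

lemma Phi_eq:
  "Phi q n k x = x ^ (n - k) * (\<Prod>i<k. 1 - x / q ^ i) / q ^ (k * (n - k))"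
  by (simp add: Phi_def power_int_minus divide_inverse mult_ac del: of_nat_mult)

lemma Phi_0_right: "Phi q n 0 x = x ^ n"
  by (simp add: Phi_eq)

lemma continuous_on_Phi: "continuous_on A (Phi q n k)"
  unfolding Phi_def by (intro continuous_intros)

lemma continuous_on_Phi_tilde: "continuous_on A (Phi_tilde q n k)"
  unfolding Phi_tilde_def by (intro continuous_intros continuous_on_Phi)

context
  fixes q :: real
  assumes q: "0 < q" "q < 1"
begin

lemma compact_Delta: "compact (Delta q)"
  unfolding Delta_eq using q by (intro compact_sequence_with_limit LIMSEQ_power_zero) auto

lemma inj_qpow: "inj (\<lambda>m::nat. q ^ m)"
  using q by (simp add: inj_on_def power_inject_exp')

lemma prob_measures_Delta_integral:
  assumes M: "M \<in> prob_measures (Delta q)" and f: "continuous_on (Delta q) f"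
  shows prob_measures_Delta_integrable: "integrable M f"
    and prob_measures_Delta_has_sum: "((\<lambda>x. f x * measure M {x}) has_sum (LINT x|M. f x)) (Delta q)"
proof -
  have "bounded (f ` Delta q)"
    by (intro compact_imp_bounded compact_continuous_image f compact_Delta)
  then obtain B where B: "\<And>x. x \<in> Delta q \<Longrightarrow> \<bar>f x\<bar> \<le> B"
    by (auto simp: bounded_iff)
  have "prob_space M" "sets M = Pow (Delta q)"
    using M by (auto simp: prob_measures_Delta_iff)
  from countable_space_integral[OF this countable_Delta, of f B] B
  show "integrable M f" "((\<lambda>x. f x * measure M {x}) has_sum (LINT x|M. f x)) (Delta q)"
    by auto
qed

text \<open>The atom at 0 is split off; the remaining points are enumerated injectively by
  \<open>q ^ m\<close>, which turns the unordered sum into a series.\<close>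

lemma integral_Delta_sums:
  assumes M: "M \<in> prob_measures (Delta q)" and f: "continuous_on (Delta q) f"
  shows "(\<lambda>m. f (q ^ m) * measure M {q ^ m}) sums ((LINT x|M. f x) - f 0 * measure M {0})"
proof -
  have "((\<lambda>x. f x * measure M {x}) has_sum (LINT x|M. f x)) (insert 0 (range (\<lambda>m. q ^ m)))"
    using prob_measures_Delta_has_sum[OF M f] by (simp add: Delta_eq)
  moreover have "((\<lambda>x. f x * measure M {x}) has_sum f 0 * measure M {0}) {0}"
    by (rule has_sum_finiteI) auto
  ultimately have "((\<lambda>x. f x * measure M {x}) has_sum ((LINT x|M. f x) - f 0 * measure M {0}))
      (insert 0 (range (\<lambda>m. q ^ m)) - {0})"
    by (rule has_sum_Diff) simp
  moreover have "insert 0 (range (\<lambda>m. q ^ m)) - {0} = range (\<lambda>m. q ^ m)"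
    using q by auto
  ultimately have "((\<lambda>x. f x * measure M {x}) has_sum ((LINT x|M. f x) - f 0 * measure M {0})) (range (\<lambda>m. q ^ m))"
    by simp
  then show ?thesis
    by (simp add: has_sum_reindex[OF inj_qpow] o_def has_sum_imp_sums)
qed

lemma measure_Delta_sums:
  assumes M: "M \<in> prob_measures (Delta q)"
  shows "(\<lambda>m. measure M {q ^ m}) sums (1 - measure M {0})"
  using integral_Delta_sums[OF M, of "\<lambda>_. 1"] M
  by (simp add: prob_measures_Delta_iff prob_space.prob_space)

text \<open>The mass at 0 is what the masses at the powers of q leave over from 1.\<close>

lemma prob_measures_Delta_eqI:
  assumes M: "M \<in> prob_measures (Delta q)" and N: "N \<in> prob_measures (Delta q)"
    and eq: "\<And>m. measure M {q ^ m} = measure N {q ^ m}"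
  shows "M = N"
proof -
  interpret M: prob_space M using M by (simp add: prob_measures_Delta_iff)
  interpret N: prob_space N using N by (simp add: prob_measures_Delta_iff)
  have "measure M {0} = measure N {0}"
    using measure_Delta_sums[OF M] measure_Delta_sums[OF N] eq by (simp add: sums_iff)
  then have "measure M {x} = measure N {x}" if "x \<in> Delta q" for x
    using that eq by (auto simp: Delta_eq)
  moreover have "sets M = Pow (Delta q)" "sets N = Pow (Delta q)"
    using M N by (simp_all add: prob_measures_Delta_iff)
  ultimately show ?thesis
    by (intro measure_eqI_countable[OF _ _ countable_Delta])
      (simp_all add: M.emeasure_eq_measure N.emeasure_eq_measure)
qed

section \<open>The kernels \<open>Phi\<close> and \<open>Phi_tilde\<close> on
  \<open>Delta q\<close>\<close>

lemma Phi_nonneg: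
  assumes "x \<in> Delta q"
  shows "0 \<le> Phi q n k x"
proof -
  \<comment> \<open>The product can be negative between points of \<open>Delta q\<close>. On
    \<open>Delta q\<close> either x is some \<open>q ^ i\<close> with i < k and a factor vanishes,
    or x lies below all these powers and no factor is negative.\<close>
  have "0 \<le> (\<Prod>i<k. 1 - x / q ^ i)"
  proof (cases "\<exists>i<k. x = q ^ i")
    case True
    then have "(\<Prod>i<k. 1 - x / q ^ i) = 0"
      using q by (intro prod_zero) auto
    then show ?thesis by (simp only: order_refl)
  next
    case False
    show ?thesis
    proof (intro prod_nonneg ballI)
      fix i assume i: "i \<in> {..<k}"
      have "x \<le> q ^ i"
        using assms False i q by (auto simp: Delta_eq intro!: power_decreasing) (metis le_less_trans not_less order.strict_implies_order)
      then show "0 \<le> 1 - x / q ^ i"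
        using q by simp
    qed
  qed
  moreover have "0 \<le> x"
    using assms q by (auto simp: Delta_eq)
  ultimately show ?thesis
    using q by (simp add: Phi_eq)
qed

text \<open>The two summands are \<open>Phi q n k x\<close> times \<open>x / q ^ k\<close> and times
  \<open>1 - x / q ^ k\<close>.\<close>

lemma Phi_rec:
  assumes "k \<le> n"
  shows "Phi q n k x = Phi q (Suc n) k x + q ^ (n - k) * Phi q (Suc n) (Suc k) x"
proof -
  obtain m where n: "n = k + m"
    using assms le_iff_add by auto
  show ?thesis
    using q by (simp add: Phi_eq n Suc_diff_le power_add field_simps)
qed

text \<open>This is the array of the point mass at x. Membership in \<open>VV q\<close> makes the
  bounds proved for all arrays available for the kernels.\<close>

lemma Phi_array_in_VV: "x \<in> Delta q \<Longrightarrow> (\<lambda>(n, k)\<in>tri. Phi q n k x) \<in> VV q"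
  by (rule VV_I) (simp_all add: tri_def Phi_0_right Phi_nonneg, rule Phi_rec)

lemma Phi_tilde_bounds:
  assumes "x \<in> Delta q" "k \<le> n"
  shows Phi_tilde_nonneg: "0 \<le> Phi_tilde q n k x" and Phi_tilde_le_1: "Phi_tilde q n k x \<le> 1"
  using VV_scaled_nonneg[OF q Phi_array_in_VV[OF assms(1)], of n k]
    VV_scaled_le_1[OF q Phi_array_in_VV[OF assms(1)], of n k] assms(2)
  by (simp_all add: tri_def Phi_tilde_def qdim_eq_qbinom[OF q])

text \<open>The prefactor of \<open>Phi\<close> is absorbed into the power, whose base
  \<open>q ^ (m - k)\<close> then shows the decay in n for m > k and the constant value 1 for m =
  k.\<close>

lemma Phi_at_qpow:
  assumes "k \<le> m" "k \<le> n"
  shows "Phi q n k (q ^ m) = (q ^ (m - k)) ^ (n - k) * (\<Prod>i<k. 1 - q ^ m / q ^ i)"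
proof -
  have "(q ^ m) ^ (n - k) / q ^ (k * (n - k)) = (q ^ (m - k)) ^ (n - k)"
    using assms q by (auto simp: le_iff_add power_add power_mult_distrib power_mult[of q k])
  then show ?thesis
    unfolding Phi_eq times_divide_eq_left[symmetric] by (simp only:)
qed

text \<open>At 0 the factor \<open>x ^ (n - k)\<close> vanishes once n > k. At \<open>q ^ m\<close>
  a factor of the product vanishes if m < k, and the power decays if m > k. If m = k, the product
  cancels the limit of the q-binomial.\<close>

lemma Phi_tilde_tendsto:
  assumes "x \<in> Delta q"
  shows "(\<lambda>n. Phi_tilde q n k x) \<longlonglongrightarrow> indicator {q ^ k} x"
proof -
  consider "x = 0" | m where "x = q ^ m" "m < k" | m where "x = q ^ m" "k \<le> m"
    using assms by (auto simp: Delta_eq) (metis not_le)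
  then show ?thesis
  proof cases
    case 1
    have "\<forall>\<^sub>F n in sequentially. indicator {q ^ k} x = Phi_tilde q n k x"
      using eventually_gt_at_top[of k] by eventually_elim (use 1 q in \<open>auto simp: Phi_tilde_def Phi_eq\<close>)
    then show ?thesis
      by (rule Lim_transform_eventually[OF tendsto_const])
  next
    case 2
    then have "(\<Prod>i<k. 1 - x / q ^ i) = 0"
      using q by (intro prod_zero) auto
    then have "Phi_tilde q n k x = 0" for n
      by (simp add: Phi_tilde_def Phi_eq)
    moreover have "x \<noteq> q ^ k"
      using 2 injD[OF inj_qpow, of m k] by auto
    ultimately show ?thesis by simp
  next
    case 3
    define P where "P = (\<Prod>i<k. 1 - q ^ m / q ^ i)"
    define L where "L = (\<Prod>i<k. 1 - q ^ Suc i)"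
    have "(\<lambda>n. (q ^ (m - k)) ^ (n - k)) \<longlonglongrightarrow> (if m = k then 1 else 0)"
    proof (cases "m = k")
      case False
      then have "q ^ (m - k) < 1"
        using 3 by (intro qpow_less_1 q) auto
      then have "(\<lambda>n. (q ^ (m - k)) ^ (n - k)) \<longlonglongrightarrow> 0"
        using q by - (rule LIMSEQ_offset[of _ k], simp add: LIMSEQ_power_zero)
      then show ?thesis using False by simp
    qed simp
    then have lim: "(\<lambda>n. qbinom q n k * ((q ^ (m - k)) ^ (n - k) * P)) \<longlonglongrightarrow> inverse L * ((if m = k then 1 else 0) * P)"
      unfolding L_def by (intro tendsto_intros qbinom_tendsto q)
    have limit: "inverse L * ((if m = k then 1 else 0) * P) = indicator {q ^ k} x"
    proof (cases "m = k")
      case True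
      \<comment> \<open>For m = k the factors are \<open>1 - q ^ (k - i)\<close>; reversing their
        order gives the product in \<open>L\<close>.\<close>
      have "P = (\<Prod>i<k. 1 - q ^ Suc (k - Suc i))"
        unfolding P_def True using q by (intro prod.cong) (auto simp: Suc_diff_Suc power_diff simp del: power_Suc)
      also have "\<dots> = L"
        unfolding L_def by (rule prod.nat_diff_reindex)
      finally have "P = L" .
      moreover have "0 < L"
        unfolding L_def using qpow_less_1[OF q] by (intro prod_pos) (auto simp del: power_Suc)
      ultimately show ?thesis using True 3 by simp
    next
      case False
      then show ?thesis using 3 injD[OF inj_qpow, of m k] by (auto simp: indicator_def)
    qed
    have "\<forall>\<^sub>F n in sequentially. qbinom q n k * ((q ^ (m - k)) ^ (n - k) * P) = Phi_tilde q n k x"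
      using eventually_ge_at_top[of k]
    proof eventually_elim
      case (elim n)
      then show ?case
        using 3 by (simp add: Phi_tilde_def Phi_at_qpow qdim_eq_qbinom[OF q] P_def)
    qed
    then show ?thesis
      by (rule Lim_transform_eventually[OF lim[unfolded limit]])
  qed
qed

section \<open>From measures to arrays and back\<close>

lemma array_of_eq_integral:
  assumes M: "M \<in> prob_measures (Delta q)" and "k \<le> n"
  shows "array_of q M (n, k) = (LINT x|M. Phi q n k x)"
  using infsumI[OF prob_measures_Delta_has_sum[OF M continuous_on_Phi]] assms(2)
  by (simp add: array_of_def tri_def)

lemma array_of_tilde_eq:
  assumes M: "M \<in> prob_measures (Delta q)"
  shows "array_of_tilde q M = (\<lambda>(n, k)\<in>tri. qdim q n k * array_of q M (n, k))"
  unfolding array_of_tilde_def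
proof (rule restrict_ext, clarify)
  fix n k assume nk: "(n, k) \<in> tri"
  have "((\<lambda>x. qdim q n k * (Phi q n k x * measure M {x})) has_sum qdim q n k * (LINT x|M. Phi q n k x)) (Delta q)"
    by (intro has_sum_cmult_right prob_measures_Delta_has_sum[OF M continuous_on_Phi])
  then show "(\<Sum>\<^sub>\<infinity>x\<in>Delta q. Phi_tilde q n k x * measure M {x}) = qdim q n k * array_of q M (n, k)"
    using array_of_eq_integral[OF M, of k n] nk by (simp add: Phi_tilde_def infsumI mult.assoc tri_def)
qed

lemma array_of_in_VV:
  assumes M: "M \<in> prob_measures (Delta q)"
  shows "array_of q M \<in> VV q"
proof -
  have int: "integrable M (Phi q n k)" for n k
    by (rule prob_measures_Delta_integrable[OF M continuous_on_Phi])
  have "array_of q M (n, k) = array_of q M (Suc n, k) + q ^ (n - k) * array_of q M (Suc n, Suc k)"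
    if "k \<le> n" for n k
    using that int Phi_rec[of k n] by (simp add: array_of_eq_integral[OF M])
  moreover have "0 \<le> array_of q M (n, k)" if "k \<le> n" for n k
    using Phi_nonneg that by (auto simp: array_of_eq_integral[OF M] space_prob_measures_Delta[OF M] intro!: integral_nonneg_AE)
  moreover have "array_of q M (0, 0) = 1"
    using M by (simp add: array_of_eq_integral[OF M] Phi_0_right prob_measures_Delta_iff prob_space.prob_space)
  moreover have "array_of q M \<in> extensional tri"
    by (simp add: array_of_def)
  ultimately show ?thesis
    by (intro VV_I)
qed

lemma array_of_tilde_tendsto:
  assumes M: "M \<in> prob_measures (Delta q)"
  shows "(\<lambda>n. array_of_tilde q M (n, k)) \<longlonglongrightarrow> measure M {q ^ k}"
proof -
  interpret prob_space M using M by (simp add: prob_measures_Delta_iff)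
  note space = space_prob_measures_Delta[OF M]
  have qk: "q ^ k \<in> Delta q"
    by (auto simp: Delta_eq)
  \<comment> \<open>The shift by k makes the bounds of \<open>Phi_tilde\<close>, which require k to
    be at most the row index, hold for every n.\<close>
  have "(\<lambda>n. LINT x|M. Phi_tilde q (n + k) k x) \<longlonglongrightarrow> (LINT x|M. indicator {q ^ k} x)"
  proof (rule integral_dominated_convergence[where w = "\<lambda>_. 1"])
    show "(\<lambda>x. indicator {q ^ k} x :: real) \<in> borel_measurable M"
      using M qk by (intro borel_measurable_indicator) (simp add: prob_measures_Delta_iff)
    show "Phi_tilde q (n + k) k \<in> borel_measurable M" for n
      by (rule borel_measurable_integrable[OF prob_measures_Delta_integrable[OF M continuous_on_Phi_tilde]])
    show "AE x in M. (\<lambda>n. Phi_tilde q (n + k) k x) \<longlonglongrightarrow> indicator {q ^ k} x"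
      by (intro AE_I2 LIMSEQ_ignore_initial_segment Phi_tilde_tendsto) (simp add: space)
    show "AE x in M. norm (Phi_tilde q (n + k) k x) \<le> 1" for n
      using Phi_tilde_bounds[of _ k "n + k"] by (intro AE_I2) (auto simp: space)
  qed simp
  moreover have "(LINT x|M. indicator {q ^ k} x) = measure M {q ^ k}"
    using qk by (simp add: space)
  moreover have "(LINT x|M. Phi_tilde q (n + k) k x) = array_of_tilde q M (n + k, k)" for n
    by (simp add: array_of_tilde_eq[OF M] array_of_eq_integral[OF M] tri_def Phi_tilde_def)
  ultimately show ?thesis
    by - (rule LIMSEQ_offset[of _ k], simp)
qed

text \<open>The missing mass goes to the point 0. A distribution \<open>w\<close> on the naturals,
  with the defect at index 0 and \<open>\<mu> m\<close> at index m + 1, is pushed forward along the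
  injection \<open>e\<close> into \<open>Delta q\<close>.\<close>

lemma prob_measure_from_masses:
  assumes nonneg: "\<And>m. 0 \<le> \<mu> m" and sm: "summable \<mu>" and le: "suminf \<mu> \<le> 1"
  obtains M where "M \<in> prob_measures (Delta q)" "\<And>m. measure M {q ^ m} = \<mu> m"
proof -
  define w where "w i = (case i of 0 \<Rightarrow> 1 - suminf \<mu> | Suc m \<Rightarrow> \<mu> m)" for i
  define e where "e i = (case i of 0 \<Rightarrow> 0 | Suc m \<Rightarrow> q ^ m)" for i :: nat
  have w_nonneg: "0 \<le> w i" for i
    using nonneg le by (auto simp: w_def split: nat.split)
  have "(\<lambda>m. w (Suc m)) sums (1 - w 0)"
    using sm by (simp add: w_def summable_sums)
  then have "w sums 1"
    by (simp add: sums_Suc_iff)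
  then have "(\<integral>\<^sup>+i. ennreal (w i) \<partial>count_space UNIV) = 1"
    using w_nonneg by (simp add: nn_integral_count_space_nat suminf_ennreal2 sums_iff)
  then have pmf: "pmf (embed_pmf w) i = w i" for i
    by (intro pmf_embed_pmf w_nonneg)
  have e: "e i \<in> Delta q" for i
    by (auto simp: e_def Delta_eq split: nat.split)
  have inj: "inj e"
    using q injD[OF inj_qpow] by (auto simp: inj_on_def e_def split: nat.splits)
  define M where "M = distr (measure_pmf (embed_pmf w)) (restrict_space borel (Delta q)) e"
  have meas: "e \<in> measurable (measure_pmf (embed_pmf w)) (restrict_space borel (Delta q))"
    using e by (simp add: space_restrict_space)
  have "M \<in> prob_measures (Delta q)"
    unfolding M_def prob_measures_def by (auto intro!: measure_pmf.prob_space_distr meas)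
  moreover have "measure M {q ^ m} = \<mu> m" for m
  proof -
    have "e -` {q ^ m} = {Suc m}"
      using injD[OF inj, of _ "Suc m"] by (auto simp: e_def)
    then show ?thesis
      unfolding M_def using e[of "Suc m"]
      by (subst measure_distr[OF meas]) (auto simp: sets_Delta e_def measure_pmf_single pmf w_def)
  qed
  ultimately show thesis
    by (rule that)
qed

lemma VV_representation:
  assumes v: "v \<in> VV q"
  obtains M where "M \<in> prob_measures (Delta q)" "array_of q M = v"
proof -
  obtain \<mu> where mu: "\<And>k. 0 \<le> \<mu> k" "summable \<mu>" "suminf \<mu> \<le> 1"
      "\<And>n. v (Suc n, 0) = (\<Sum>k. q ^ (Suc n * k) * \<mu> k)"
    using VV_first_column_moments[OF q v] by metis
  then obtain M where M: "M \<in> prob_measures (Delta q)" "\<And>m. measure M {q ^ m} = \<mu> m"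
    using prob_measure_from_masses by metis
  \<comment> \<open>By \<open>VV_eqI\<close> the first columns suffice. Row 0 is treated apart, by
    normalization, because the moment formula covers positive orders only.\<close>
  have "array_of q M (n, 0) = v (n, 0)" for n
  proof (cases n)
    case 0
    then show ?thesis using VV_0[OF v] VV_0[OF array_of_in_VV[OF M(1)]] by simp
  next
    case (Suc j)
    \<comment> \<open>As n is positive here, \<open>0 ^ n\<close> is 0 and the atom at 0 drops
      out.\<close>
    have "(\<lambda>m. (q ^ m) ^ n * \<mu> m) sums (array_of q M (n, 0) - 0 ^ n * measure M {0})"
      using integral_Delta_sums[OF M(1), of "\<lambda>x. x ^ n"]
      by (simp add: array_of_eq_integral[OF M(1)] Phi_0_right M(2) continuous_intros)
    then show ?thesis
      using mu(4)[of j] by (simp add: Suc sums_iff power_mult[symmetric] mult.commute del: power_Suc mult_Suc mult_Suc_right)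
  qed
  then have "array_of q M = v"
    using q by (intro VV_eqI[of q] array_of_in_VV M v) auto
  with M show thesis
    using that by blast
qed

end

section \<open>Topology and convexity\<close>

lemma topspace_entrywise_topology:
  assumes "A \<subseteq> extensional tri"
  shows "topspace (entrywise_topology A) = A"
  using assms by (auto simp: entrywise_topology_def PiE_def)

lemma continuous_map_entry:
  "p \<in> tri \<Longrightarrow> continuous_map (entrywise_topology A) euclideanreal (\<lambda>v. v p)"
  unfolding entrywise_topology_def
  by (intro continuous_map_from_subtopology continuous_map_product_projection)

lemma continuous_map_into_entrywise:
  assumes "A \<subseteq> extensional tri" "f \<in> topspace X \<rightarrow> A"
    and "\<And>p. p \<in> tri \<Longrightarrow> continuous_map X euclideanreal (\<lambda>x. f x p)"
  shows "continuous_map X (entrywise_topology A) f"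
  unfolding entrywise_topology_def
  using assms by (intro continuous_map_into_subtopology) (auto simp: continuous_map_componentwise)

lemma continuous_map_weak_integral:
  assumes "continuous_on D f"
  shows "continuous_map (weak_topology D) euclideanreal (\<lambda>M. LINT x|M. f x)"
  unfolding continuous_map_def topspace_weak_topology
proof (intro conjI allI impI)
  fix U :: "real set" assume "openin euclideanreal U"
  then show "openin (weak_topology D) {M \<in> prob_measures D. (LINT x|M. f x) \<in> U}"
    unfolding weak_topology_def using assms by (intro topology_generated_by_Basis) auto
qed auto

text \<open>Continuity need only be tested on the generating sets, which are preimages of open sets
  under integration of one function.\<close>

lemma continuous_map_into_weak:
  assumes "g \<in> topspace X \<rightarrow> prob_measures D"
    and "\<And>f :: real \<Rightarrow> real. continuous_on D f \<Longrightarrow> continuous_map X euclideanreal (\<lambda>y. LINT x|g y. f x)"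
  shows "continuous_map X (weak_topology D) g"
  unfolding weak_topology_def
proof (rule continuous_on_generated_topo)
  fix S assume "S \<in> {{M \<in> prob_measures D. (LINT x|M. f x) \<in> U} | f U.
        continuous_on D (f :: real \<Rightarrow> real) \<and> open U}"
  then obtain f :: "real \<Rightarrow> real" and U where f: "continuous_on D f" and U: "open U"
    and S: "S = {M \<in> prob_measures D. (LINT x|M. f x) \<in> U}"
    by blast
  have "openin X {y \<in> topspace X. (LINT x|g y. f x) \<in> U}"
    using openin_continuous_map_preimage[OF assms(2)[OF f]] U by simp
  also have "{y \<in> topspace X. (LINT x|g y. f x) \<in> U} = g -` S \<inter> topspace X"
    using assms(1) by (auto simp: S)
  finally show "openin X (g -` S \<inter> topspace X)" .
next
  show "g ` topspace X \<subseteq> \<Union> {{M \<in> prob_measures D. (LINT x|M. f x) \<in> U} | f U.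
        continuous_on D (f :: real \<Rightarrow> real) \<and> open U}"
    using assms(1) topspace_weak_topology[of D]
    unfolding weak_topology_def topology_generated_by_topspace by auto
qed

section \<open>Convex combinations of measures\<close>

lemma mixture_in_prob_measures:
  assumes M: "M \<in> prob_measures D" and N: "N \<in> prob_measures D" and t: "t \<in> {0..1}"
  shows "mixture t M N \<in> prob_measures D"
proof -
  interpret M: prob_space M using M by (simp add: prob_measures_def)
  interpret N: prob_space N using N by (simp add: prob_measures_def)
  have sets: "sets N = sets M"
    using M N by (simp add: prob_measures_def)
  have space: "space N = space M" "space (mixture t M N) = space M"
    by (intro sets_eq_imp_space_eq sets sets_mixture)+
  have "emeasure (mixture t M N) (space M) = ennreal t + ennreal (1 - t)"
    using M.emeasure_space_1 N.emeasure_space_1 by (simp add: emeasure_mixture[OF sets] space)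
  also have "\<dots> = 1"
    using t by (simp flip: ennreal_plus)
  finally have "prob_space (mixture t M N)"
    by (intro prob_spaceI) (simp add: space)
  then show ?thesis
    using M by (simp add: prob_measures_def)
qed

lemma measure_mixture:
  assumes M: "M \<in> prob_measures D" and N: "N \<in> prob_measures D" and t: "t \<in> {0..1}"
    and A: "A \<in> sets M"
  shows "measure (mixture t M N) A = t * measure M A + (1 - t) * measure N A"
proof -
  interpret M: prob_space M using M by (simp add: prob_measures_def)
  interpret N: prob_space N using N by (simp add: prob_measures_def)
  have "sets N = sets M"
    using M N by (simp add: prob_measures_def)
  from emeasure_mixture[OF this A] show ?thesis
    using t by (simp add: measure_def[of "mixture t M N"] M.emeasure_eq_measure N.emeasure_eq_measure
        flip: ennreal_mult ennreal_plus)
qed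

context
  fixes q :: real
  assumes q: "0 < q" "q < 1"
begin

section \<open>The homeomorphisms, their linearity and the limit formula\<close>

lemma array_of_tilde_eqI:
  assumes M: "M \<in> prob_measures (Delta q)" and N: "N \<in> prob_measures (Delta q)"
    and "array_of_tilde q M = array_of_tilde q N"
  shows "M = N"
proof (rule prob_measures_Delta_eqI[OF q M N])
  show "measure M {q ^ m} = measure N {q ^ m}" for m
    using array_of_tilde_tendsto[OF q M, of m] array_of_tilde_tendsto[OF q N, of m]
    unfolding assms(3) by (rule LIMSEQ_unique)
qed

lemma bij_betw_array_of: "bij_betw (array_of q) (prob_measures (Delta q)) (VV q)"
proof (rule bij_betw_imageI)
  show "inj_on (array_of q) (prob_measures (Delta q))"
    \<comment> \<open>Equal arrays have equal rescaled arrays, whose limits determine the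
      measure.\<close>
    by (rule inj_onI, rule array_of_tilde_eqI) (simp_all add: array_of_tilde_eq[OF q])
  show "array_of q ` prob_measures (Delta q) = VV q"
    using array_of_in_VV[OF q] VV_representation[OF q] by blast
qed

text \<open>Here \<open>g\<close> stands for the inverse of \<open>array_of q\<close>. Its weak
  continuity is reduced to single integrals, first of polynomials and then, by uniform
  approximation, of continuous functions.\<close>

lemma continuous_map_integral_of_array:
  assumes g: "\<And>v. v \<in> VV q \<Longrightarrow> g v \<in> prob_measures (Delta q) \<and> array_of q (g v) = v"
    and f: "continuous_on (Delta q) f"
  shows "continuous_map (entrywise_topology (VV q)) euclideanreal (\<lambda>v. LINT x|g v. f x)"
proof -
  have ext: "VV q \<subseteq> extensional tri"
    using VV_extensional by blast
  have pol: "continuous_map (entrywise_topology (VV q)) euclideanreal (\<lambda>v. LINT x|g v. p x)"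
    if p: "polynomial_function p" for p :: "real \<Rightarrow> real"
  proof -
    obtain a d where p: "p = (\<lambda>x. \<Sum>i\<le>d. a i * x ^ i)"
      using p real_polynomial_function_iff_sum by (auto simp flip: real_polynomial_function_eq)
    \<comment> \<open>Since \<open>Phi q i 0 x = x ^ i\<close>, the i-th moment of
      \<open>g v\<close> is the entry \<open>v (i, 0)\<close>, so a polynomial integral is a finite
      linear combination of entries.\<close>
    have "continuous_map (entrywise_topology (VV q)) euclideanreal (\<lambda>v. \<Sum>i\<le>d. a i * v (i, 0))"
      by (intro continuous_intros continuous_map_entry) (auto simp: tri_def)
    then show ?thesis
    proof (rule continuous_map_eq)
      fix v assume "v \<in> topspace (entrywise_topology (VV q))"
      then have v: "g v \<in> prob_measures (Delta q)" "array_of q (g v) = v"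
        using g by (auto simp: topspace_entrywise_topology[OF ext])
      have int: "integrable (g v) (\<lambda>x. a i * x ^ i)" for i
        by (intro prob_measures_Delta_integrable[OF q v(1)] continuous_intros)
      have "(LINT x|g v. p x) = (\<Sum>i\<le>d. a i * (LINT x|g v. x ^ i))"
        using int by (simp add: p)
      also have "\<dots> = (\<Sum>i\<le>d. a i * v (i, 0))"
        using array_of_eq_integral[OF q v(1), of 0] by (simp add: v(2) Phi_0_right)
      finally show "(\<Sum>i\<le>d. a i * v (i, 0)) = (LINT x|g v. p x)" ..
    qed
  qed
  have "\<exists>p. polynomial_function p \<and> (\<forall>x\<in>Delta q. norm (f x - p x) < inverse (real (Suc i)))" for i
    by (rule Stone_Weierstrass_polynomial_function[OF compact_Delta[OF q] f]) simp
  then obtain p where p: "\<And>i. polynomial_function (p i)"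
    and close: "\<And>i x. x \<in> Delta q \<Longrightarrow> \<bar>f x - p i x\<bar> < inverse (real (Suc i))"
    by (metis real_norm_def)
  \<comment> \<open>Every \<open>g v\<close> has mass 1, so the sup-norm error of the approximation
    bounds the error of the integrals uniformly in v, and a uniform limit of continuous maps is
    continuous.\<close>
  have "continuous_map (entrywise_topology (VV q)) Met_TC.mtopology (\<lambda>v. LINT x|g v. f x)"
  proof (rule Met_TC.continuous_map_uniform_limit[where F = sequentially and f = "\<lambda>i v. LINT x|g v. p i x"])
    show "\<forall>\<^sub>F i in sequentially. continuous_map (entrywise_topology (VV q)) Met_TC.mtopology (\<lambda>v. LINT x|g v. p i x)"
      using pol p by simp
    fix e :: real assume e: "0 < e"
    have "\<forall>\<^sub>F i in sequentially. inverse (real (Suc i)) < e"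
      using order_tendstoD(2)[OF LIMSEQ_inverse_real_of_nat e] .
    then show "\<forall>\<^sub>F i in sequentially. \<forall>v\<in>topspace (entrywise_topology (VV q)).
        (LINT x|g v. f x) \<in> UNIV \<and> dist (LINT x|g v. p i x) (LINT x|g v. f x) < e"
    proof eventually_elim
      case (elim i)
      have "dist (LINT x|g v. p i x) (LINT x|g v. f x) < e" if "v \<in> topspace (entrywise_topology (VV q))" for v
      proof -
        have v: "g v \<in> prob_measures (Delta q)"
          using that g by (simp add: topspace_entrywise_topology[OF ext])
        interpret prob_space "g v" using v by (simp add: prob_measures_def)
        have int: "integrable (g v) f" "integrable (g v) (p i)"
          by (intro prob_measures_Delta_integrable[OF q v] f continuous_on_polymonial_function p)+
        have "\<bar>(LINT x|g v. p i x - f x)\<bar> \<le> (LINT x|g v. \<bar>p i x - f x\<bar>)"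
          by (rule integral_abs_bound)
        also have "\<dots> \<le> (LINT x|g v. inverse (real (Suc i)))"
          using int close by (intro integral_mono_AE AE_I2)
            (auto simp: space_prob_measures_Delta[OF v] abs_minus_commute less_imp_le)
        also have "\<dots> = inverse (real (Suc i))"
          by (simp add: prob_space)
        finally show ?thesis
          using elim int by (simp add: dist_real_def)
      qed
      then show ?case by blast
    qed
  qed simp
  then show ?thesis by simp
qed

lemma homeomorphic_map_array_of:
  "homeomorphic_map (weak_topology (Delta q)) (entrywise_topology (VV q)) (array_of q)"
proof -
  have ext: "VV q \<subseteq> extensional tri"
    using VV_extensional by blast
  define g where "g = inv_into (prob_measures (Delta q)) (array_of q)"
  have gf: "g (array_of q M) = M" if "M \<in> prob_measures (Delta q)" for M
    using bij_betw_array_of that by (simp add: g_def bij_betw_inv_into_left)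
  have g: "g v \<in> prob_measures (Delta q) \<and> array_of q (g v) = v" if "v \<in> VV q" for v
    using bij_betw_array_of that
    by (auto simp: g_def bij_betw_inv_into_right bij_betw_def intro: inv_into_into)
  have "homeomorphic_maps (weak_topology (Delta q)) (entrywise_topology (VV q)) (array_of q) g"
    unfolding homeomorphic_maps_def topspace_weak_topology topspace_entrywise_topology[OF ext]
  proof (intro conjI ballI)
    show "continuous_map (weak_topology (Delta q)) (entrywise_topology (VV q)) (array_of q)"
    proof (rule continuous_map_into_entrywise[OF ext])
      fix p assume "p \<in> tri"
      then obtain n k where p: "p = (n, k)" "k \<le> n"
        by (auto simp: tri_def)
      show "continuous_map (weak_topology (Delta q)) euclideanreal (\<lambda>M. array_of q M p)"
        by (rule continuous_map_eq[OF continuous_map_weak_integral[OF continuous_on_Phi[of _ q n k]]])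
          (simp add: topspace_weak_topology p array_of_eq_integral[OF q])
    qed (simp add: topspace_weak_topology array_of_in_VV[OF q])
    show "continuous_map (entrywise_topology (VV q)) (weak_topology (Delta q)) g"
      using g continuous_map_integral_of_array[OF g]
      by (intro continuous_map_into_weak) (auto simp: topspace_entrywise_topology[OF ext])
  qed (use g gf in auto)
  then show ?thesis
    using homeomorphic_map_maps by blast
qed

text \<open>For k at most n the factor \<open>qdim q n k\<close> is positive, so entrywise division
  inverts the scaling; both maps are continuous in each coordinate.\<close>

lemma homeomorphic_map_qdim_scaling:
  "homeomorphic_map (entrywise_topology (VV q)) (entrywise_topology (VV_tilde q))
    (\<lambda>v. \<lambda>(n, k)\<in>tri. qdim q n k * v (n, k))"
proof -
  define S where "S v = (\<lambda>(n, k)\<in>tri. qdim q n k * v (n, k))" for v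
  define T where "T v = (\<lambda>(n, k)\<in>tri. v (n, k) / qdim q n k)" for v
  have ext: "VV q \<subseteq> extensional tri"
    using VV_extensional by blast
  have tilde: "VV_tilde q = S ` VV q"
    by (simp add: VV_tilde_def S_def)
  then have ext': "VV_tilde q \<subseteq> extensional tri"
    by (auto simp: S_def)
  have TS: "T (S v) = v" if "v \<in> VV q" for v
  proof (rule extensionalityI[of _ tri])
    show "T (S v) p = v p" if "p \<in> tri" for p
      using that qbinom_pos[OF q] qdim_eq_qbinom[OF q] by (force simp: T_def S_def tri_def)
  qed (use that ext in \<open>auto simp: T_def\<close>)
  have "homeomorphic_maps (entrywise_topology (VV q)) (entrywise_topology (VV_tilde q)) S T"
    unfolding homeomorphic_maps_def topspace_entrywise_topology[OF ext] topspace_entrywise_topology[OF ext']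
  proof (intro conjI)
    show "continuous_map (entrywise_topology (VV q)) (entrywise_topology (VV_tilde q)) S"
    proof (rule continuous_map_into_entrywise[OF ext'])
      fix p assume "p \<in> tri"
      then show "continuous_map (entrywise_topology (VV q)) euclideanreal (\<lambda>v. S v p)"
        by (cases p) (auto simp: S_def intro!: continuous_intros continuous_map_entry)
    qed (simp add: topspace_entrywise_topology[OF ext] tilde)
    show "continuous_map (entrywise_topology (VV_tilde q)) (entrywise_topology (VV q)) T"
    proof (rule continuous_map_into_entrywise[OF ext])
      fix p assume "p \<in> tri"
      then show "continuous_map (entrywise_topology (VV_tilde q)) euclideanreal (\<lambda>v. T v p)"
        by (cases p) (auto simp: T_def divide_inverse intro!: continuous_intros continuous_map_entry)
    qed (unfold topspace_entrywise_topology[OF ext'], auto simp: tilde TS)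
  qed (auto simp: tilde TS)
  then show ?thesis
    using homeomorphic_map_maps unfolding S_def by blast
qed

lemma homeomorphic_map_array_of_tilde:
  "homeomorphic_map (weak_topology (Delta q)) (entrywise_topology (VV_tilde q)) (array_of_tilde q)"
proof (rule homeomorphic_map_eq)
  show "homeomorphic_map (weak_topology (Delta q)) (entrywise_topology (VV_tilde q))
      ((\<lambda>v. \<lambda>(n, k)\<in>tri. qdim q n k * v (n, k)) \<circ> array_of q)"
    by (rule homeomorphic_map_compose[OF homeomorphic_map_array_of homeomorphic_map_qdim_scaling])
qed (simp add: topspace_weak_topology array_of_tilde_eq[OF q])

text \<open>The series defining the array is linear in the atom masses, and
  \<open>measure_mixture\<close> gives the masses of the mixture.\<close>

lemma array_of_mixture:
  assumes M: "M \<in> prob_measures (Delta q)" and N: "N \<in> prob_measures (Delta q)" and t: "t \<in> {0..1}"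
    and nk: "k \<le> n"
  shows "array_of q (mixture t M N) (n, k) = t * array_of q M (n, k) + (1 - t) * array_of q N (n, k)"
proof -
  have "((\<lambda>x. t * (Phi q n k x * measure M {x}) + (1 - t) * (Phi q n k x * measure N {x})) has_sum
      (t * (LINT x|M. Phi q n k x) + (1 - t) * (LINT x|N. Phi q n k x))) (Delta q)"
    by (intro has_sum_add has_sum_cmult_right prob_measures_Delta_has_sum[OF q] M N continuous_on_Phi)
  also have "?this \<longleftrightarrow> ((\<lambda>x. Phi q n k x * measure (mixture t M N) {x}) has_sum
      (t * (LINT x|M. Phi q n k x) + (1 - t) * (LINT x|N. Phi q n k x))) (Delta q)"
  proof (rule has_sum_cong)
    fix x assume "x \<in> Delta q"
    then show "t * (Phi q n k x * measure M {x}) + (1 - t) * (Phi q n k x * measure N {x}) =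
        Phi q n k x * measure (mixture t M N) {x}"
      using M by (simp add: measure_mixture[OF M N t] prob_measures_Delta_iff algebra_simps)
  qed
  finally show ?thesis
    using nk array_of_eq_integral[OF q M nk] array_of_eq_integral[OF q N nk]
    by (simp add: array_of_def[of q "mixture t M N"] tri_def infsumI)
qed

lemma array_of_tilde_mixture:
  assumes M: "M \<in> prob_measures (Delta q)" and N: "N \<in> prob_measures (Delta q)" and t: "t \<in> {0..1}"
    and nk: "k \<le> n"
  shows "array_of_tilde q (mixture t M N) (n, k) =
    t * array_of_tilde q M (n, k) + (1 - t) * array_of_tilde q N (n, k)"
  using nk
  by (simp add: array_of_mixture[OF assms] array_of_tilde_eq[OF q] M N mixture_in_prob_measures[OF M N t] tri_def algebra_simps)

lemma array_of_tilde_eq_iff: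
  assumes v: "v \<in> VV_tilde q" and M: "M \<in> prob_measures (Delta q)"
  shows "array_of_tilde q M = v \<longleftrightarrow>
    (\<forall>m. (\<lambda>n. v (n, m)) \<longlonglongrightarrow> measure M {q ^ m}) \<and>
    summable (\<lambda>m. measure M {q ^ m}) \<and>
    measure M {0} = 1 - (\<Sum>m. measure M {q ^ m})"
proof
  assume "array_of_tilde q M = v"
  then show "(\<forall>m. (\<lambda>n. v (n, m)) \<longlonglongrightarrow> measure M {q ^ m}) \<and>
      summable (\<lambda>m. measure M {q ^ m}) \<and> measure M {0} = 1 - (\<Sum>m. measure M {q ^ m})"
    using array_of_tilde_tendsto[OF q M] measure_Delta_sums[OF q M] by (auto simp: sums_iff)
next
  assume lim: "(\<forall>m. (\<lambda>n. v (n, m)) \<longlonglongrightarrow> measure M {q ^ m}) \<and>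
      summable (\<lambda>m. measure M {q ^ m}) \<and> measure M {0} = 1 - (\<Sum>m. measure M {q ^ m})"
  \<comment> \<open>Some measure \<open>N\<close> has v as its rescaled array. Uniqueness of limits
    gives \<open>M\<close> and \<open>N\<close> the same masses at all powers of q, so they
    coincide.\<close>
  obtain w where w: "w \<in> VV q" "v = (\<lambda>(n, k)\<in>tri. qdim q n k * w (n, k))"
    using v unfolding VV_tilde_def by blast
  obtain N where "N \<in> prob_measures (Delta q)" "array_of q N = w"
    using VV_representation[OF q w(1)] .
  then have N: "N \<in> prob_measures (Delta q)" "array_of_tilde q N = v"
    using array_of_tilde_eq[OF q] w(2) by auto
  have "M = N"
  proof (rule prob_measures_Delta_eqI[OF q M N(1)])
    show "measure M {q ^ m} = measure N {q ^ m}" for m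
      using lim array_of_tilde_tendsto[OF q N(1), of m] unfolding N(2) by (blast intro: LIMSEQ_unique)
  qed
  then show "array_of_tilde q M = v"
    using N(2) by simp
qed

end

theorem theorem3p2:
  fixes q :: real
  assumes "0 < q" and "q < 1"
  shows
    "((\<forall>M \<in> prob_measures (Delta q). \<forall>n k. k \<le> n \<longrightarrow>
         (\<lambda>x. Phi_tilde q n k x * measure M {x}) summable_on Delta q \<and>
         (\<lambda>x. Phi q n k x * measure M {x}) summable_on Delta q) \<and>
      homeomorphic_map (weak_topology (Delta q)) (entrywise_topology (VV_tilde q))
         (array_of_tilde q) \<and>
      homeomorphic_map (weak_topology (Delta q)) (entrywise_topology (VV q)) (array_of q) \<and>
      (\<forall>M \<in> prob_measures (Delta q). \<forall>N \<in> prob_measures (Delta q). \<forall>t \<in> {0..1}.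
         mixture t M N \<in> prob_measures (Delta q) \<and>
         (\<forall>n k. k \<le> n \<longrightarrow>
            array_of_tilde q (mixture t M N) (n, k) =
              t * array_of_tilde q M (n, k) + (1 - t) * array_of_tilde q N (n, k) \<and>
            array_of q (mixture t M N) (n, k) =
              t * array_of q M (n, k) + (1 - t) * array_of q N (n, k)))) \<and>
     (\<forall>v \<in> VV_tilde q. \<forall>M \<in> prob_measures (Delta q).
        array_of_tilde q M = v \<longleftrightarrow>
          (\<forall>m. (\<lambda>n. v (n, m)) \<longlonglongrightarrow> measure M {q ^ m}) \<and>
          summable (\<lambda>m. measure M {q ^ m}) \<and>
          measure M {0} = 1 - (\<Sum>m. measure M {q ^ m}))"
proof (intro conjI ballI allI impI)
  fix M n k assume "M \<in> prob_measures (Delta q)"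
  then show "(\<lambda>x. Phi_tilde q n k x * measure M {x}) summable_on Delta q"
    and "(\<lambda>x. Phi q n k x * measure M {x}) summable_on Delta q"
    by (rule has_sum_imp_summable[OF prob_measures_Delta_has_sum[OF assms]],
        intro continuous_on_Phi_tilde continuous_on_Phi)+
qed (use assms in \<open>simp_all only: homeomorphic_map_array_of_tilde homeomorphic_map_array_of
      mixture_in_prob_measures array_of_mixture array_of_tilde_mixture array_of_tilde_eq_iff\<close>)

end
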